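(* Let $[X]=[\underline{X},\overline{X}]$ be a random interval with density function $f_{[X]}\colon\mathbb{R}^2\to\mathbb{R}$. Then the containment distribution function $F_{[X]}$ of $[X]$ is given, for all real $\underline{x}\le\overline{x}$, by $$F_{[X]}(\underline{x},\overline{x})=\int_{\underline{x}}^{\overline{x}}\int_{\underline{x}}^{\overline{x}} f_{[X]}(\underline{x}',\overline{x}')\,\mathrm{d}\underline{x}'\,\mathrm{d}\overline{x}'.$$
   Context: $\mathbb{I}=\{[x,y]\colon -\infty<x\le y<+\infty\}$ is the set of closed bounded intervals of $\mathbb{R}$ (including degenerate ones); for $[x]\in\mathbb{I}$ write $[x]=[\underline{x},\overline{x}]$. $\mathbb{I}$ carries the Hausdorff metric $d_H([a],[b])=\max\{|\underline{a}-\underline{b}|,|\overline{a}-\overline{b}|\}$ and its Borel $\sigma$-algebra; the map $h([x])=(\underline{x},\overline{x})$ identifies $\mathbb{I}$ isometrically with $\{(u,v)\in\mathbb{R}^2\colon u\le v\}$ under the sup metric. A random interval $[X]=[\underline{X},\overline{X}]$ is a random element of $\mathbb{I}$, i.e. a random vector $(\underline{X},\overline{X})$ with $\underline{X}\le\overline{X}$. Its density function $f_{[X]}$ is the density of $(\underline{X},\overline{X})$ with respect to Lebesgue measure on $\mathbb{R}^2$; it is zero at $(u,v)$ with $u>v$. The containment distribution function of $[X]$ is $F_{[X]}\colon\mathbb{R}^2\to[0,1]$, $F_{[X]}(\underline{x},\overline{x})=P([X]\subseteq[\underline{x},\overline{x}])$ for $\underline{x}\le\overline{x}$, and $F_{[X]}(\underline{x},\overline{x})=0$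 for $\underline{x}>\overline{x}$. *)

theory Defs
  imports "HOL-Probability.Probability" "HOL-Library.Interval"
begin

definition interval_dist :: "real interval \<Rightarrow> real interval \<Rightarrow> real" where
  "interval_dist a b = max \<bar>lower a - lower b\<bar> \<bar>upper a - upper b\<bar>"

interpretation interval_metric: Metric_space UNIV interval_dist
  by unfold_locales (auto simp: interval_dist_def interval_eq_iff)

text \<open>
  The Borel \<open>\<sigma>\<close>-algebra is built from the Hausdorff metric instead of using \<^const>\<open>borel\<close>:
  the \<^class>\<open>topological_space\<close> instance that \<^theory>\<open>HOL-Library.Interval\<close> provides for intervals
  requires \<open>Interval ` (A \<times> B) \<subseteq> X\<close> for products of open sets, which at a degenerate interval
  involves the unspecified values \<open>Interval (u, v)\<close> with \<open>u > v\<close>.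
\<close>

definition interval_borel :: "real interval measure" where
  "interval_borel = sigma UNIV {U. openin interval_metric.mtopology U}"

lemma space_interval_borel [simp]: "space interval_borel = UNIV"
  by (simp add: interval_borel_def)

lemma sets_interval_borel:
  "sets interval_borel = sigma_sets UNIV {U. openin interval_metric.mtopology U}"
  by (simp add: interval_borel_def)

definition random_interval :: "'w measure \<Rightarrow> ('w \<Rightarrow> real interval) \<Rightarrow> bool" where
  "random_interval M X \<longleftrightarrow> prob_space M \<and> X \<in> M \<rightarrow>\<^sub>M interval_borel"

text \<open>
  Nonnegativity is required explicitly because \<^const>\<open>ennreal\<close> truncates negative values to 0.
\<close>

definition interval_density ::
    "'w measure \<Rightarrow> ('w \<Rightarrow> real interval) \<Rightarrow> (real \<times> real \<Rightarrow> real) \<Rightarrow> bool" where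
  "interval_density M X f \<longleftrightarrow>
     (\<forall>p. 0 \<le> f p) \<and>
     (\<forall>u v. u > v \<longrightarrow> f (u, v) = 0) \<and>
     distributed M lborel (\<lambda>\<omega>. (lower (X \<omega>), upper (X \<omega>))) (\<lambda>p. ennreal (f p))"

definition containment_distribution ::
    "'w measure \<Rightarrow> ('w \<Rightarrow> real interval) \<Rightarrow> real \<times> real \<Rightarrow> real" where
  "containment_distribution M X = (\<lambda>(a, b).
     if a \<le> b then measure M {\<omega> \<in> space M. set_of (X \<omega>) \<subseteq> {a..b}} else 0)"

end

theory Submission
  imports Defs
begin

text \<open>An interval lies in [a,b] exactly when its endpoint pair lies in the square
  \<open>{a..b} \<times> {a..b}\<close> (\<open>set_of_subset_iff\<close>). Containment is thus an
  event about a random vector with density \<open>f\<close>, and its probability is the integral of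
  \<open>f\<close> over the square (\<open>distributed_set_integral\<close>). Fubini makes this an
  iterated integral (\<open>set_integral_Times_swap\<close>).\<close>

lemma set_of_subset_iff:
  fixes I :: "'a::linorder interval"
  shows "set_of I \<subseteq> {a..b} \<longleftrightarrow> (lower I, upper I) \<in> {a..b} \<times> {a..b}"
  \<comment> \<open>The square also demands the crossed bounds \<open>lower I \<le> b\<close> and
    \<open>a \<le> upper I\<close>; these follow from \<open>lower I \<le> upper I\<close>.\<close>
  by (auto simp: set_of_eq intro: order_trans[OF lower_le_upper] order_trans[OF _ lower_le_upper])

text \<open>Passes from the extended nonnegative integral defining a density to the real one: a
  probability is finite, so the nonnegative \<open>f\<close> is integrable on
  \<open>S\<close>.\<close>

lemma distributed_set_integral:
  assumes "prob_space M"
    and "distributed M N Y (\<lambda>p. ennreal (f p))"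
    and "\<And>p. 0 \<le> f p"
    and "S \<in> sets N"
  shows "set_integrable N S f"
    and "measure M (Y -` S \<inter> space M) = (LINT p:S|N. f p)"
proof -
  interpret prob_space M by fact
  have [measurable]: "f \<in> borel_measurable N"
    by (rule distributed_real_measurable) (use assms in auto)
  have [measurable]: "S \<in> sets N" by fact
  let ?g = "\<lambda>p. indicator S p * f p"
  have *: "emeasure M (Y -` S \<inter> space M) = (\<integral>\<^sup>+p. ennreal (?g p) \<partial>N)"
    unfolding distributed_emeasure[OF assms(2,4)]
    by (intro nn_integral_cong) (auto simp: indicator_def)
  show "set_integrable N S f"
    unfolding set_integrable_def real_scaleR_def
    by (rule integrableI_nonneg)
      (use assms(3) in \<open>auto simp: *[symmetric] emeasure_eq_measure\<close>)
  show "measure M (Y -` S \<inter> space M) = (LINT p:S|N. f p)"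
    unfolding set_lebesgue_integral_def real_scaleR_def measure_def *
    by (rule integral_eq_nn_integral[symmetric]) (use assms(3) in auto)
qed

lemma set_integral_Times_swap:
  fixes f :: "real \<times> real \<Rightarrow> real"
  assumes "set_integrable lborel (A \<times> B) f"
  shows "(LINT p:A \<times> B|lborel. f p) = (LINT v:B|lborel. (LINT u:A|lborel. f (u, v)))"
proof -
  have "(LINT p:A \<times> B|lborel. f p)
      = (LINT v|lborel. (LINT u|lborel. indicator (A \<times> B) (u, v) *\<^sub>R f (u, v)))"
    unfolding set_lebesgue_integral_def
    \<comment> \<open>Fubini in the form that leaves the second coordinate outermost.\<close>
    using lborel_pair.integral_snd[of "\<lambda>u v. indicator (A \<times> B) (u, v) *\<^sub>R f (u, v)"] assms
    by (simp add: lborel_prod set_integrable_def case_prod_beta')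
  also have "\<dots> = (LINT v:B|lborel. (LINT u:A|lborel. f (u, v)))"
    unfolding set_lebesgue_integral_def
    \<comment> \<open>\<open>indicator B v\<close> is constant in u and so passes through the inner
      integral, even for a v whose section is not integrable, where that integral is 0 by
      convention.\<close>
    by (simp add: indicator_times mult_ac flip: integral_mult_right_zero)
  finally show ?thesis .
qed

theorem theorem1:
  fixes M :: "'w measure"
    and X :: "'w \<Rightarrow> real interval"
    and f :: "real \<times> real \<Rightarrow> real"
    and a b :: real
  assumes "random_interval M X"
    and "interval_density M X f"
    and "a \<le> b"
  shows "containment_distribution M X (a, b) =
    (LBINT v=ereal a..ereal b. (LBINT u=ereal a..ereal b. f (u, v)))"
proof -
  let ?Y = "\<lambda>\<omega>. (lower (X \<omega>), upper (X \<omega>))"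
  let ?S = "{a..b} \<times> {a..b}"
  have M: "prob_space M" using assms(1) by (simp add: random_interval_def)
  have d: "distributed M lborel ?Y (\<lambda>p. ennreal (f p))" and f: "\<And>p. 0 \<le> f p"
    using assms(2) by (auto simp: interval_density_def)
  have S: "?S \<in> sets lborel"
    by (simp add: borel_closed closed_Times)
  have "containment_distribution M X (a, b) = measure M (?Y -` ?S \<inter> space M)"
    using assms(3) unfolding containment_distribution_def
    by (auto simp: set_of_subset_iff intro!: arg_cong[where f="measure M"])
  also have "\<dots> = (LINT p:?S|lborel. f p)"
    by (rule distributed_set_integral(2)[OF M d f S])
  also have "\<dots> = (LINT v:{a..b}|lborel. (LINT u:{a..b}|lborel. f (u, v)))"
    by (rule set_integral_Times_swap[OF distributed_set_integral(1)[OF M d f S]])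
  \<comment> \<open>Interval integrals run over the open interval, but endpoints are null;
    \<open>a \<le> b\<close> fixes the sign.\<close>
  also have "\<dots> = (LBINT v=ereal a..ereal b. (LBINT u=ereal a..ereal b. f (u, v)))"
    using assms(3) by (simp add: interval_integral_Icc)
  finally show ?thesis .
qed

end
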